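(* The one-dimensional semi-discrete nodal DG scheme described in the context, written as $\frac{\mathrm d\mathbf U_h}{\mathrm dt}=\mathcal L_h(\mathbf U_h)$, is well-balanced for a general known equilibrium state solution $\mathbf U^e=(\rho^e,m^e,\mathcal E^e)^T$; that is, $$\mathcal L_h(\mathbf U_h)=\mathbf 0\qquad\text{if}\quad \mathbf U_h=\mathbf U_h^e,$$ where $\mathbf U_h^e$ is the piecewise polynomial interpolating $\mathbf U^e$ at the Gauss–Lobatto points of each cell.
   Context: **Equations.** 1D Euler equations with gravity $\mathbf U_t+\mathbf F(\mathbf U)_x=\mathbf S(\mathbf U,x)$ on $\Omega=[a,b]$, $\mathbf U=(\rho,m,\mathcal E)^T$, $m=\rho u$, $\mathbf F(\mathbf U)=(m,\rho u^2+p,u(\mathcal E+p))^T$, $\mathbf S(\mathbf U,x)=(0,-\rho\phi_x,-m\phi_x)^T$, with given time-independent potential $\phi(x)$ and $\mathcal E=\frac p{\gamma-1}+\frac12\rho u^2$, $\gamma=1.4$. Admissible set: $\mathscr G=\{(\rho,m,\mathcal E):\rho>0,\ p>0\}$. With $s=\ln(p\rho^{-\gamma})$, the entropy variable is $\mathbf V(\mathbf U)=\big(\frac{\gamma-s}{\gamma-1}-\frac{\rho u^2}{2p},\ \frac{\rho u}{p},\ -\frac{\rho}{p}\big)^T$ and the potential flux is $\psi=\rho u$. **Equilibrium.** $\mathbf U^e=(\rho^e,m^e,\mathcal E^e)^T:\Omega\to\mathscr G$ is a given (classical) steady state, hydrostatic ($m^e=0$) or moving ($m^e\neq0$): $\mathbf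 F(\mathbf U^e)_x=\mathbf S(\mathbf U^e,x)$. **Discretization.** $\Omega$ is split into $N$ uniform cells $K_i=[x_{i-1/2},x_{i+1/2}]$ of length $\Delta x$ and center $x_i$. $-1=X_0<\dots<X_k=1$ ($k\ge1$) are the Gauss–Lobatto points on $[-1,1]$ with quadrature weights $\omega_0,\dots,\omega_k$; $L_l$ are the Lagrange basis polynomials at these points; $D_{jl}=L_l'(X_j)$; $\tau_0=-1$, $\tau_k=1$, $\tau_j=0$ otherwise. $x_i(X)=x_i+\frac{\Delta x}2X$. The unknown $\mathbf U_h$ is piecewise polynomial of degree $\le k$, determined by nodal values $\mathbf U_{i_1}^i=\mathbf U_h|_{K_i}(x_i(X_{i_1}))$; $\mathbf U_{i_1}^{e,i}=\mathbf U^e(x_i(X_{i_1}))$ are the nodal values of $\mathbf U_h^e$; $\mathbf F_{i_1}^i=\mathbf F(\mathbf U_{i_1}^i)$. $\mathbf F^S(\mathbf U_L,\mathbf U_R)$ is an entropy conservative flux: consistent ($\mathbf F^S(\mathbf U,\mathbf U)=\mathbf F(\mathbf U)$), symmetric, and $(\mathbf V_R-\mathbf V_L)^T\mathbf F^S(\mathbf U_L,\mathbf U_R)=\psi_R-\psi_L$. $\hat{\mathbf F}(\mathbf U_L,\mathbf U_R)=\frac12(\mathbf F(\mathbf U_L)+\mathbf F(\mathbf U_R))-\frac\alpha2(\mathbf U_R-\mathbf U_L)$ is the Lax–Friedrichs flux, where $\alpha=\alpha(\mathbf U_L,\mathbf U_R)>0$ is an estimate of the maximal local wave speed. $\hat{\mathbf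 F}_{i+1/2}=\hat{\mathbf F}(\mathbf U_k^i,\mathbf U_0^{i+1})$; $\mathbf F_0^{*,i}=\hat{\mathbf F}_{i-1/2}$, $\mathbf F_k^{*,i}=\hat{\mathbf F}_{i+1/2}$, $\mathbf F_{i_1}^{*,i}=0$ for $0<i_1<k$. **Scheme.** For all $i,i_1$, $$\frac{\mathrm d\mathbf U_{i_1}^i}{\mathrm dt}+\frac2{\Delta x}\sum_{l=0}^k2D_{i_1,l}\mathbf F^S(\mathbf U_{i_1}^i,\mathbf U_l^i)+\frac2{\Delta x}\frac{\tau_{i_1}}{\omega_{i_1}}(\mathbf F_{i_1}^{*,i}-\mathbf F_{i_1}^i)=\mathbf S_{i_1}^i+\mathbf S_{i_1}^{0,i}-\mathbf S_{i_1}^{corr,i},$$ and $\mathcal L_h(\mathbf U_h)$ denotes the resulting expression for $\mathrm d\mathbf U_{i_1}^i/\mathrm dt$. Here, with $\phi_{x,i_1}^i=\phi_x(x_i(X_{i_1}))$, $\mathbf S_{i_1}^i=(0,-\rho_{i_1}^i\phi_{x,i_1}^i,-m_{i_1}^i\phi_{x,i_1}^i)^T$, $\mathbf S_{i_1}^{e,i}=(0,-\rho_{i_1}^{e,i}\phi_{x,i_1}^i,-m_{i_1}^{e,i}\phi_{x,i_1}^i)^T$, $$\mathbf S_{i_1}^{0,i}=\frac2{\Delta x}\sum_{l=0}^k2D_{i_1,l}\mathbf F^S(\mathbf U_{i_1}^{e,i},\mathbf U_l^{e,i})-\mathbf S_{i_1}^{e,i},\qquad \mathbf S_{i_1}^{corr,i}=\sigma_i(\mathbf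 V_{i_1}^i-\bar{\mathbf V}^i),$$ $$\sigma_i=\frac{\sum_{i_1=0}^k\omega_{i_1}(\mathbf V_{i_1}^i-\mathbf V_{i_1}^{e,i})^T\mathbf S_{i_1}^{0,i}}{\sum_{i_1=0}^k\omega_{i_1}\|\mathbf V_{i_1}^i-\bar{\mathbf V}^i\|^2},\quad \mathbf V_{i_1}^i=\mathbf V(\mathbf U_{i_1}^i),\ \mathbf V_{i_1}^{e,i}=\mathbf V(\mathbf U_{i_1}^{e,i}),\ \bar{\mathbf V}^i=\sum_{i_1=0}^k\frac{\omega_{i_1}}2\mathbf V_{i_1}^i;$$ if the denominator of $\sigma_i$ is zero, $\mathbf S_{i_1}^{corr,i}=\mathbf 0$. **Boundary treatment.** The exterior traces used at $x=a$ and $x=b$ are consistent with the equilibrium: when $\mathbf U_h=\mathbf U_h^e$, they equal the interior traces, i.e. $\mathbf U_k^0=\mathbf U^e(a)$ and $\mathbf U_0^{N+1}=\mathbf U^e(b)$. *)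

theory Defs
  imports "HOL-Analysis.Analysis" "HOL-Computational_Algebra.Polynomial"
begin

text \<open>States are vectors \<open>U = (\<rho>, m, E)\<close> in \<open>real ^ 3\<close>. All formulas below involving division
  are only meaningful on the admissible set.\<close>

definition gas_gamma :: real where
  "gas_gamma = 1.4"

definition velocity :: "real ^ 3 \<Rightarrow> real" where
  "velocity U = U $ 2 / U $ 1"

text \<open>The equation of state \<open>E = p / (\<gamma> - 1) + \<rho> u\<^sup>2 / 2\<close>, solved for the pressure.\<close>

definition pressure :: "real ^ 3 \<Rightarrow> real" where
  "pressure U = (gas_gamma - 1) * (U $ 3 - U $ 1 * (velocity U)\<^sup>2 / 2)"

definition admissible :: "(real ^ 3) set" where
  "admissible = {U. U $ 1 > 0 \<and> pressure U > 0}"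

definition euler_flux :: "real ^ 3 \<Rightarrow> real ^ 3" where
  "euler_flux U = vector [U $ 2, U $ 1 * (velocity U)\<^sup>2 + pressure U,
                          velocity U * (U $ 3 + pressure U)]"

text \<open>The second argument is the value of \<open>\<phi>\<^sub>x\<close> at the point considered.\<close>

definition grav_source :: "real ^ 3 \<Rightarrow> real \<Rightarrow> real ^ 3" where
  "grav_source U g = vector [0, - (U $ 1) * g, - (U $ 2) * g]"

definition phys_entropy :: "real ^ 3 \<Rightarrow> real" where
  "phys_entropy U = ln (pressure U * U $ 1 powr (- gas_gamma))"

definition entropy_var :: "real ^ 3 \<Rightarrow> real ^ 3" where
  "entropy_var U = vector
     [(gas_gamma - phys_entropy U) / (gas_gamma - 1) - U $ 1 * (velocity U)\<^sup>2 / (2 * pressure U),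
      U $ 1 * velocity U / pressure U,
      - (U $ 1) / pressure U]"

definition potential_flux :: "real ^ 3 \<Rightarrow> real" where
  "potential_flux U = U $ 1 * velocity U"

definition entropy_conservative :: "(real ^ 3 \<Rightarrow> real ^ 3 \<Rightarrow> real ^ 3) \<Rightarrow> bool" where
  "entropy_conservative FS \<longleftrightarrow>
     (\<forall>U\<in>admissible. FS U U = euler_flux U) \<and>
     (\<forall>UL\<in>admissible. \<forall>UR\<in>admissible. FS UL UR = FS UR UL) \<and>
     (\<forall>UL\<in>admissible. \<forall>UR\<in>admissible.
        (entropy_var UR - entropy_var UL) \<bullet> FS UL UR = potential_flux UR - potential_flux UL)"

definition lax_friedrichs ::
  "(real ^ 3 \<Rightarrow> real ^ 3 \<Rightarrow> real) \<Rightarrow> real ^ 3 \<Rightarrow> real ^ 3 \<Rightarrow> real ^ 3" where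
  "lax_friedrichs \<alpha> UL UR =
     (1/2) *\<^sub>R (euler_flux UL + euler_flux UR) - (\<alpha> UL UR / 2) *\<^sub>R (UR - UL)"

text \<open>Classical steady states; derivatives at the end points of the interval are one-sided.\<close>

definition classical_steady_state ::
  "real \<Rightarrow> real \<Rightarrow> (real \<Rightarrow> real) \<Rightarrow> (real \<Rightarrow> real ^ 3) \<Rightarrow> bool" where
  "classical_steady_state a b \<phi>x Ue \<longleftrightarrow>
     (\<forall>x\<in>{a..b}. Ue x \<in> admissible) \<and> Ue differentiable_on {a..b} \<and>
     (\<forall>x\<in>{a..b}. ((\<lambda>y. euler_flux (Ue y)) has_vector_derivative grav_source (Ue x) (\<phi>x x))
                    (at x within {a..b}))"

text \<open>The Gauss--Lobatto rule with \<open>k + 1\<close> nodes is the unique rule on \<open>[-1, 1]\<close> that includes both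
  end points and is exact for polynomials of degree at most \<open>2 k - 1\<close>.\<close>

definition gauss_lobatto :: "nat \<Rightarrow> (nat \<Rightarrow> real) \<Rightarrow> (nat \<Rightarrow> real) \<Rightarrow> bool" where
  "gauss_lobatto k X \<omega> \<longleftrightarrow>
     strict_mono_on {0..k} X \<and> X 0 = -1 \<and> X k = 1 \<and>
     (\<forall>q :: real poly. degree q \<le> 2 * k - 1 \<longrightarrow>
        integral {-1..1} (poly q) = (\<Sum>j=0..k. \<omega> j * poly q (X j)))"

text \<open>The parameters of the scheme: domain \<open>[a, b]\<close> with \<open>N\<close> uniform cells numbered \<open>1, \<dots>, N\<close>,
  polynomial degree \<open>k\<close>, nodes \<open>X\<close> and weights \<open>\<omega>\<close>, potential gradient \<open>\<phi>x\<close>, entropy conservative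
  flux \<open>FS\<close>, wave speed estimate \<open>\<alpha>\<close>, equilibrium \<open>Ue\<close>. The boundary treatment is given by
  \<open>BL\<close> and \<open>BR\<close>, which assign to a discrete solution its exterior traces at \<open>a\<close> and \<open>b\<close>.

  A discrete solution \<open>Uh\<close> assigns to each cell a vector of polynomials in the physical
  coordinate \<open>x\<close>. The locale carries no assumptions; it only fixes the parameters.\<close>

locale euler_dg =
  fixes a b :: real and N k :: nat and X \<omega> :: "nat \<Rightarrow> real" and \<phi>x :: "real \<Rightarrow> real"
    and FS :: "real ^ 3 \<Rightarrow> real ^ 3 \<Rightarrow> real ^ 3" and \<alpha> :: "real ^ 3 \<Rightarrow> real ^ 3 \<Rightarrow> real"
    and Ue :: "real \<Rightarrow> real ^ 3"
    and BL BR :: "(nat \<Rightarrow> real poly ^ 3) \<Rightarrow> real ^ 3"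
begin

definition \<Delta>x :: real where
  "\<Delta>x = (b - a) / real N"

definition center :: "nat \<Rightarrow> real" where
  "center i = a + (real i - 1/2) * \<Delta>x"

definition cell_map :: "nat \<Rightarrow> real \<Rightarrow> real" where
  "cell_map i \<xi> = center i + \<Delta>x / 2 * \<xi>"

definition lagrange :: "nat \<Rightarrow> real poly" where
  "lagrange l = (\<Prod>m\<in>{0..k} - {l}. smult (1 / (X l - X m)) [:- X m, 1:])"

definition D :: "nat \<Rightarrow> nat \<Rightarrow> real" where
  "D j l = poly (pderiv (lagrange l)) (X j)"

definition \<tau> :: "nat \<Rightarrow> real" where
  "\<tau> j = (if j = 0 then -1 else if j = k then 1 else 0)"

definition nodal :: "(nat \<Rightarrow> real poly ^ 3) \<Rightarrow> nat \<Rightarrow> nat \<Rightarrow> real ^ 3" where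
  "nodal Uh i j = (\<chi> c. poly (Uh i $ c) (cell_map i (X j)))"

definition nodal_eq :: "nat \<Rightarrow> nat \<Rightarrow> real ^ 3" where
  "nodal_eq i j = Ue (cell_map i (X j))"

text \<open>Piecewise polynomial interpolant of the equilibrium. The inner polynomial is the inverse
  of the cell map.\<close>

definition interp_eq :: "nat \<Rightarrow> real poly ^ 3" where
  "interp_eq i = (\<chi> c. \<Sum>l=0..k. smult (nodal_eq i l $ c)
                          (pcompose (lagrange l) [:- 2 * center i / \<Delta>x, 2 / \<Delta>x:]))"

text \<open>The numerical flux at the interface \<open>x\<^bsub>i+1/2\<^esub>\<close> for \<open>i = 0, \<dots>, N\<close>.\<close>

definition interface_flux :: "(nat \<Rightarrow> real poly ^ 3) \<Rightarrow> nat \<Rightarrow> real ^ 3" where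
  "interface_flux Uh i = lax_friedrichs \<alpha>
     (if i = 0 then BL Uh else nodal Uh i k)
     (if i = N then BR Uh else nodal Uh (i + 1) 0)"

definition Fstar :: "(nat \<Rightarrow> real poly ^ 3) \<Rightarrow> nat \<Rightarrow> nat \<Rightarrow> real ^ 3" where
  "Fstar Uh i j = (if j = 0 then interface_flux Uh (i - 1)
                   else if j = k then interface_flux Uh i else 0)"

definition source :: "(nat \<Rightarrow> real poly ^ 3) \<Rightarrow> nat \<Rightarrow> nat \<Rightarrow> real ^ 3" where
  "source Uh i j = grav_source (nodal Uh i j) (\<phi>x (cell_map i (X j)))"

definition source_eq :: "nat \<Rightarrow> nat \<Rightarrow> real ^ 3" where
  "source_eq i j = grav_source (nodal_eq i j) (\<phi>x (cell_map i (X j)))"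

definition source0 :: "nat \<Rightarrow> nat \<Rightarrow> real ^ 3" where
  "source0 i j = (2 / \<Delta>x) *\<^sub>R (\<Sum>l=0..k. (2 * D j l) *\<^sub>R FS (nodal_eq i j) (nodal_eq i l))
                 - source_eq i j"

definition V :: "(nat \<Rightarrow> real poly ^ 3) \<Rightarrow> nat \<Rightarrow> nat \<Rightarrow> real ^ 3" where
  "V Uh i j = entropy_var (nodal Uh i j)"

definition V_eq :: "nat \<Rightarrow> nat \<Rightarrow> real ^ 3" where
  "V_eq i j = entropy_var (nodal_eq i j)"

definition V_mean :: "(nat \<Rightarrow> real poly ^ 3) \<Rightarrow> nat \<Rightarrow> real ^ 3" where
  "V_mean Uh i = (\<Sum>j=0..k. (\<omega> j / 2) *\<^sub>R V Uh i j)"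

definition sigma_num :: "(nat \<Rightarrow> real poly ^ 3) \<Rightarrow> nat \<Rightarrow> real" where
  "sigma_num Uh i = (\<Sum>j=0..k. \<omega> j * ((V Uh i j - V_eq i j) \<bullet> source0 i j))"

definition sigma_den :: "(nat \<Rightarrow> real poly ^ 3) \<Rightarrow> nat \<Rightarrow> real" where
  "sigma_den Uh i = (\<Sum>j=0..k. \<omega> j * (norm (V Uh i j - V_mean Uh i))\<^sup>2)"

definition source_corr :: "(nat \<Rightarrow> real poly ^ 3) \<Rightarrow> nat \<Rightarrow> nat \<Rightarrow> real ^ 3" where
  "source_corr Uh i j =
     (if sigma_den Uh i = 0 then 0
      else (sigma_num Uh i / sigma_den Uh i) *\<^sub>R (V Uh i j - V_mean Uh i))"

definition L_h :: "(nat \<Rightarrow> real poly ^ 3) \<Rightarrow> nat \<Rightarrow> nat \<Rightarrow> real ^ 3" where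
  "L_h Uh i j =
     - (2 / \<Delta>x) *\<^sub>R (\<Sum>l=0..k. (2 * D j l) *\<^sub>R FS (nodal Uh i j) (nodal Uh i l))
     - (2 / \<Delta>x * (\<tau> j / \<omega> j)) *\<^sub>R (Fstar Uh i j - euler_flux (nodal Uh i j))
     + source Uh i j + source0 i j - source_corr Uh i j"

end

end

theory Submission
  imports Defs
begin

text \<open>At the equilibrium the flux and source residuals of the volume terms cancel exactly, because
  \<open>S\<^sup>0\<close> is built from the same discrete flux differences. The interface terms vanish because
  \<open>U\<^sup>e\<close> is single-valued at cell interfaces and the Lax--Friedrichs flux is consistent, and the numerator of
  \<open>\<sigma>\<^sub>i\<close> vanishes because \<open>V = V\<^sup>e\<close>.\<close>

lemma lax_friedrichs_same: "lax_friedrichs \<alpha> U U = euler_flux U"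
  by (simp add: lax_friedrichs_def flip: scaleR_add_left)

context euler_dg
begin

lemma poly_lagrange_node:
  assumes "inj_on X {0..k}" "j \<in> {0..k}" "l \<in> {0..k}"
  shows "poly (lagrange l) (X j) = (if j = l then 1 else 0)"
proof (cases "j = l")
  case True
  have "poly (smult (1 / (X l - X m)) [:- X m, 1:]) (X l) = 1" if "m \<in> {0..k} - {l}" for m
    using inj_onD[OF assms(1), of l m] that assms(3) by (auto simp flip: diff_divide_distrib)
  then have "poly (lagrange l) (X l) = 1"
    unfolding lagrange_def poly_prod by (intro prod.neutral) blast
  then show ?thesis
    using True by simp
next
  case False
  \<comment> \<open>The witness is \<open>m = j\<close>: since \<open>j\<close> differs from
    \<open>l\<close>, this factor occurs in the product, and its numerator vanishes at
    \<open>X j\<close>.\<close>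
  then have "\<exists>m\<in>{0..k} - {l}. poly (smult (1 / (X l - X m)) [:- X m, 1:]) (X j) = 0"
    using assms(2) by (intro bexI[of _ j]) auto
  then have "poly (lagrange l) (X j) = 0"
    unfolding lagrange_def poly_prod by (intro prod_zero) simp_all
  then show ?thesis
    using False by simp
qed

text \<open>The inner polynomial of \<open>interp_eq\<close> inverts \<open>cell_map\<close>, so
  evaluation at a physical node reduces to the Lagrange basis at the reference node
  \<open>X j\<close>, where only the term \<open>l = j\<close> survives.\<close>

lemma nodal_interp_eq:
  assumes "\<Delta>x \<noteq> 0" "inj_on X {0..k}" "j \<in> {0..k}"
  shows "nodal interp_eq i j = nodal_eq i j"
proof -
  have inv: "poly [:- 2 * center i / \<Delta>x, 2 / \<Delta>x:] (cell_map i (X j)) = X j"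
    using assms(1) by (simp add: cell_map_def field_simps)
  have "(\<Sum>l=0..k. nodal_eq i l $ c * poly (lagrange l) (X j)) = nodal_eq i j $ c" for c
  proof -
    have "(\<Sum>l=0..k. nodal_eq i l $ c * poly (lagrange l) (X j))
        = (\<Sum>l=0..k. if j = l then nodal_eq i l $ c else 0)"
      by (rule sum.cong) (auto simp: poly_lagrange_node[OF assms(2,3)])
    then show ?thesis
      using assms(3) by simp
  qed
  then show ?thesis
    unfolding nodal_def interp_eq_def
    by (simp only: vec_eq_iff vec_lambda_beta poly_sum poly_smult poly_pcompose inv simp_thms)
qed

text \<open>Neighbouring centers are one cell width apart. At \<open>i = 0\<close> the left side is
  the right end of a fictitious cell 0, which lets the boundary point \<open>a\<close> be treated
  like any other interface.\<close>

lemma cell_map_right_eq_left: "cell_map i 1 = cell_map (i + 1) (- 1)"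
  by (simp add: cell_map_def center_def field_simps)

lemma cell_map_left_end: "cell_map 1 (- 1) = a"
  by (simp add: cell_map_def center_def)

lemma cell_map_right_end:
  assumes "N > 0"
  shows "cell_map N 1 = b"
  using assms by (simp add: cell_map_def center_def \<Delta>x_def field_simps)

text \<open>Both traces equal \<open>Ue\<close> at the common interface point, so consistency
  applies. At the two boundary points this is what the hypotheses on \<open>BL\<close> and
  \<open>BR\<close> provide.\<close>

lemma interface_flux_interp_eq:
  assumes "\<Delta>x \<noteq> 0" "inj_on X {0..k}" "X 0 = - 1" "X k = 1" "N > 0"
    and "BL interp_eq = Ue a" "BR interp_eq = Ue b"
  shows "interface_flux interp_eq i = euler_flux (Ue (cell_map i 1))"
proof -
  have left: "(if i = 0 then BL interp_eq else nodal interp_eq i k) = Ue (cell_map i 1)"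
    using assms nodal_interp_eq[OF assms(1,2), of k i] cell_map_right_eq_left[of 0] cell_map_left_end
    by (auto simp: nodal_eq_def)
  have right: "(if i = N then BR interp_eq else nodal interp_eq (i + 1) 0) = Ue (cell_map i 1)"
    using assms nodal_interp_eq[OF assms(1,2), of 0 "i + 1"] cell_map_right_eq_left[of i]
      cell_map_right_end
    by (auto simp: nodal_eq_def)
  show ?thesis
    unfolding interface_flux_def left right by (rule lax_friedrichs_same)
qed

lemma L_h_interp_eq:
  assumes "\<Delta>x \<noteq> 0" "inj_on X {0..k}" "X 0 = - 1" "X k = 1" "N > 0"
    and "BL interp_eq = Ue a" "BR interp_eq = Ue b"
    and "i > 0" "j \<in> {0..k}"
  shows "L_h interp_eq i j = 0"
proof -
  have nodal: "nodal interp_eq i l = nodal_eq i l" if "l \<in> {0..k}" for l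
    using nodal_interp_eq[OF assms(1,2) that] .
  \<comment> \<open>Restricted to the end nodes, because \<open>Fstar\<close> is 0 by convention at
    interior ones. At \<open>j = 0\<close> the interface index is \<open>i - 1\<close>, a true
    predecessor since \<open>i > 0\<close>.\<close>
  have flux: "Fstar interp_eq i j = euler_flux (nodal interp_eq i j)" if "\<tau> j \<noteq> 0"
    using that assms(3,4,8,9) cell_map_right_eq_left[of "i - 1"] nodal[of j]
    by (auto simp: \<tau>_def Fstar_def nodal_eq_def interface_flux_interp_eq[OF assms(1-7)]
        split: if_splits)
  have "sigma_num interp_eq i = 0"
    by (simp add: sigma_num_def V_def V_eq_def nodal)
  \<comment> \<open>A zero denominator gives 0 by the default value; otherwise the quotient has
    numerator 0.\<close>
  then have corr: "source_corr interp_eq i j = 0"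
    by (simp add: source_corr_def)
  \<comment> \<open>At interior nodes the prefactor vanishes through \<open>\<tau> j = 0\<close>; at
    end nodes the flux difference does.\<close>
  have surface: "(2 / \<Delta>x * (\<tau> j / \<omega> j)) *\<^sub>R (Fstar interp_eq i j - euler_flux (nodal interp_eq i j)) = 0"
    using flux by auto
  have volume: "(\<Sum>l=0..k. (2 * D j l) *\<^sub>R FS (nodal interp_eq i j) (nodal interp_eq i l))
      = (\<Sum>l=0..k. (2 * D j l) *\<^sub>R FS (nodal_eq i j) (nodal_eq i l))"
    using assms(9) by (intro sum.cong) (simp_all add: nodal)
  have source: "source interp_eq i j = source_eq i j"
    using assms(9) by (simp add: source_def source_eq_def nodal)
  show ?thesis
    unfolding L_h_def surface corr volume source source0_def by simp
qed

end

theorem theorem3p3: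
  fixes a b :: real and N k :: nat and X \<omega> :: "nat \<Rightarrow> real"
    and \<phi> \<phi>x :: "real \<Rightarrow> real"
    and FS :: "real ^ 3 \<Rightarrow> real ^ 3 \<Rightarrow> real ^ 3"
    and \<alpha> :: "real ^ 3 \<Rightarrow> real ^ 3 \<Rightarrow> real"
    and Ue :: "real \<Rightarrow> real ^ 3"
    and BL BR :: "(nat \<Rightarrow> real poly ^ 3) \<Rightarrow> real ^ 3"
    and Ueh :: "nat \<Rightarrow> real poly ^ 3"
  assumes "a < b" and "N \<ge> 1" and "k \<ge> 1"
    and "gauss_lobatto k X \<omega>"
    and "\<forall>x\<in>{a..b}. (\<phi> has_real_derivative \<phi>x x) (at x within {a..b})"
    and "classical_steady_state a b \<phi>x Ue"
    and "entropy_conservative FS"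
    and "\<forall>UL\<in>admissible. \<forall>UR\<in>admissible. \<alpha> UL UR > 0"
    and "Ueh = euler_dg.interp_eq a b N k X Ue"
    and "BL Ueh = Ue a" and "BR Ueh = Ue b"
  shows "\<forall>Uh. Uh = Ueh \<longrightarrow>
           (\<forall>i\<in>{1..N}. \<forall>j\<in>{0..k}. euler_dg.L_h a b N k X \<omega> \<phi>x FS \<alpha> Ue BL BR Uh i j = 0)"
proof (intro allI impI ballI)
  fix Uh i j
  assume Uh: "Uh = Ueh" and i: "i \<in> {1..N}" and j: "j \<in> {0..k}"
  have "strict_mono_on {0..k} X" and ends: "X 0 = - 1" "X k = 1"
    using assms(4) by (auto simp: gauss_lobatto_def)
  then have "inj_on X {0..k}"
    by (simp add: strict_mono_on_imp_inj_on)
  then show "euler_dg.L_h a b N k X \<omega> \<phi>x FS \<alpha> Ue BL BR Uh i j = 0"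
    unfolding Uh assms(9)
    using assms(1,2,9-11) i j ends
    by (intro euler_dg.L_h_interp_eq) (auto simp: euler_dg.\<Delta>x_def)
qed

end
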